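(* Let $Q\in\mathbb{R}^{n\times n}$ be a symmetric positive definite matrix, $\tilde b\in\mathbb{R}^n$ and $c\in\mathbb{R}$. Then the sequence $\{x^k\}$ generated by the semi-smooth Newton method $$x^{k+1}=-\left([Q-\mathrm{I}]P(x^k)+\mathrm{I}\right)^{-1}\tilde b,\qquad k=0,1,\ldots,$$ for solving the equation $[Q-\mathrm{I}]x^+ + x=-\tilde b$ is well defined for any starting point $x^0\in\mathbb{R}^n$. Moreover, if $$\|Q-\mathrm{I}\|<1/2,$$ then (for any starting point) the sequence $\{x^k\}$ converges $Q$-linearly to $x^*\in\mathbb{R}^n$, the unique solution of $[Q-\mathrm{I}]x^+ + x=-\tilde b$, as follows: $$\|x^*-x^{k+1}\|\le \frac{\|Q-\mathrm{I}\|}{1-\|Q-\mathrm{I}\|}\,\|x^*-x^k\|,\qquad k=0,1,\ldots,$$ and $(x^* )^+$ is a solution of the problem of minimizing $\frac12 x^\top Qx+x^\top\tilde b+c$ subject to $x\in\mathbb{R}^n_+$.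
   Context: For $x\in\mathbb{R}^n$, $x^+$ is the vector with $i$-th component $\max\{x_i,0\}$. $\mathrm{sgn}(x)$ is the vector whose $i$-th component is $1$, $0$ or $-1$ according to whether $x_i$ is positive, zero or negative. $\mathrm{diag}(x)$ is the diagonal matrix with $(i,i)$-th entry $x_i$, and $P(x):=\mathrm{diag}(\mathrm{sgn}(x^+))$. $\mathrm{I}$ is the $n\times n$ identity matrix and $\mathbb{R}^n_+$ is the nonnegative orthant. $\|\cdot\|$ is the Euclidean norm on $\mathbb{R}^n$ and, for a matrix $M$, $\|M\|:=\max\{\|Mx\| : x\in\mathbb{R}^n,\ \|x\|=1\}$. "Well defined" means that the matrix inverted at each step is nonsingular. $Q$-linear convergence to $x^*$ (here "Q" is part of the standard term, unrelated to the matrix $Q$) means that $x^k\to x^*$ and there is a constant $r\in[0,1)$ with $\|x^*-x^{k+1}\|\le r\|x^*-x^k\|$ for all (sufficiently large) $k$. *)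

theory Defs
  imports "HOL-Analysis.Analysis"
begin

definition pos_part :: "real ^ 'n \<Rightarrow> real ^ 'n" where
  "pos_part x = (\<chi> i. max (x $ i) 0)"

text \<open>Componentwise sign: the overloaded \<^const>\<open>sgn\<close> on vectors is the normalization
  \<open>x /\<^sub>R norm x\<close>, so it is only used on components.\<close>

definition sgn_vec :: "real ^ 'n \<Rightarrow> real ^ 'n" where
  "sgn_vec x = (\<chi> i. sgn (x $ i))"

definition diag :: "real ^ 'n \<Rightarrow> real ^ 'n ^ 'n" where
  "diag x = (\<chi> i j. if i = j then x $ i else 0)"

definition P :: "real ^ 'n \<Rightarrow> real ^ 'n ^ 'n" where
  "P x = diag (sgn_vec (pos_part x))"

definition nonneg_orthant :: "(real ^ 'n) set" where
  "nonneg_orthant = {x. \<forall>i. 0 \<le> x $ i}"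

definition sym_pos_def :: "real ^ 'n ^ 'n \<Rightarrow> bool" where
  "sym_pos_def Q \<longleftrightarrow> transpose Q = Q \<and> (\<forall>x. x \<noteq> 0 \<longrightarrow> 0 < x \<bullet> (Q *v x))"

definition mat_norm :: "real ^ 'n ^ 'n \<Rightarrow> real" where
  "mat_norm M = onorm ((*v) M)"

text \<open>The operator norm is the maximum of \<open>norm (M *v x)\<close> over unit vectors.\<close>

lemma mat_norm_is_max:
  fixes M :: "real ^ 'n ^ 'n"
  shows "mat_norm M \<in> {norm (M *v x) | x. norm x = 1}"
    and "\<And>x. norm x = 1 \<Longrightarrow> norm (M *v x) \<le> mat_norm M"
proof -
  have bl: "bounded_linear ((*v) M)"
    by (rule matrix_vector_mul_bounded_linear)
  show le: "norm (M *v x) \<le> mat_norm M" if "norm x = 1" for x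
    using onorm[OF bl, of x] that by (simp add: mat_norm_def)
  have "axis undefined 1 \<in> (sphere 0 1 :: (real ^ 'n) set)"
    by simp
  then have "(sphere 0 1 :: (real ^ 'n) set) \<noteq> {}"
    by blast
  moreover have "continuous_on (sphere 0 1) (\<lambda>x. norm (M *v x))"
    by (intro continuous_on_norm linear_continuous_on bl)
  ultimately obtain u :: "real ^ 'n" where u: "u \<in> sphere 0 1"
    and umax: "\<forall>y\<in>sphere 0 1. norm (M *v y) \<le> norm (M *v u)"
    using continuous_attains_sup[OF compact_sphere] by blast
  have "norm (M *v x) \<le> norm (M *v u) * norm x" for x
  proof (cases "x = 0")
    case False
    have "norm (M *v (x /\<^sub>R norm x)) \<le> norm (M *v u)"
      using umax False by simp
    then show ?thesis
      using False by (simp add: matrix_vector_mult_scaleR field_simps)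
  qed simp
  then have "mat_norm M \<le> norm (M *v u)"
    unfolding mat_norm_def by (rule onorm_le)
  with le[of u] u have "mat_norm M = norm (M *v u)"
    by simp
  with u show "mat_norm M \<in> {norm (M *v x) | x. norm x = 1}"
    by auto
qed

definition newton_matrix :: "real ^ 'n ^ 'n \<Rightarrow> real ^ 'n \<Rightarrow> real ^ 'n ^ 'n" where
  "newton_matrix Q x = (Q - mat 1) ** P x + mat 1"

text \<open>Since \<^const>\<open>matrix_inv\<close> is total, the recursion always yields some sequence; it is the
  Newton sequence exactly when it is well defined in the sense of \<open>newton_well_defined\<close>.\<close>

primrec newton_seq ::
    "real ^ 'n ^ 'n \<Rightarrow> real ^ 'n \<Rightarrow> real ^ 'n \<Rightarrow> nat \<Rightarrow> real ^ 'n" where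
  "newton_seq Q b x0 0 = x0"
| "newton_seq Q b x0 (Suc k) = - (matrix_inv (newton_matrix Q (newton_seq Q b x0 k)) *v b)"

definition newton_well_defined ::
    "real ^ 'n ^ 'n \<Rightarrow> real ^ 'n \<Rightarrow> real ^ 'n \<Rightarrow> bool" where
  "newton_well_defined Q b x0 \<longleftrightarrow> (\<forall>k. invertible (newton_matrix Q (newton_seq Q b x0 k)))"

definition solves_equation :: "real ^ 'n ^ 'n \<Rightarrow> real ^ 'n \<Rightarrow> real ^ 'n \<Rightarrow> bool" where
  "solves_equation Q b x \<longleftrightarrow> (Q - mat 1) *v pos_part x + x = - b"

definition q_linearly_convergent :: "(nat \<Rightarrow> 'a::real_normed_vector) \<Rightarrow> 'a \<Rightarrow> bool" where
  "q_linearly_convergent X l \<longleftrightarrow>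
     X \<longlonglongrightarrow> l \<and>
     (\<exists>r. 0 \<le> r \<and> r < 1 \<and> (\<forall>\<^sub>F k in sequentially. norm (l - X (Suc k)) \<le> r * norm (l - X k)))"

definition quadratic_objective ::
    "real ^ 'n ^ 'n \<Rightarrow> real ^ 'n \<Rightarrow> real \<Rightarrow> real ^ 'n \<Rightarrow> real" where
  "quadratic_objective Q b c x = 1 / 2 * (x \<bullet> (Q *v x)) + x \<bullet> b + c"

end

theory Submission
  imports Defs
begin

text \<open>A vector in the kernel of the Newton matrix has a masked part \<open>u\<close> with \<open>u \<bullet> Q u = 0\<close>, hence is
  zero. If \<open>x\<^sup>*\<close> solves the equation and \<open>x'\<close> is the Newton step from \<open>x\<close>, subtracting the two
  equations gives \<open>x\<^sup>* - x' = - (Q - I) (P(x) (x\<^sup>* - x') + d)\<close>, where \<open>d = (x\<^sup>*)\<^sup>+ - P(x) x\<^sup>*\<close> is bounded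
  componentwise by \<open>\<bar>x\<^sup>* - x\<bar>\<close>. Hence \<open>\<parallel>x\<^sup>* - x'\<parallel> \<le> \<parallel>Q - I\<parallel> (\<parallel>x\<^sup>* - x'\<parallel> + \<parallel>x\<^sup>* - x\<parallel>)\<close>, which is the linear rate.
  Existence and uniqueness come from the contraction
  \<open>x \<mapsto> - b - (Q - I) x\<^sup>+\<close>. Finally \<open>Q (x\<^sup>*)\<^sup>+ + b = (x\<^sup>*)\<^sup>+ - x\<^sup>*\<close> is nonnegative and orthogonal to
  \<open>(x\<^sup>*)\<^sup>+\<close>, which are the optimality conditions of the convex quadratic program.\<close>

lemma P_mult_nth: "(P x *v v) $ i = (if 0 < x $ i then v $ i else 0)"
  by (simp add: matrix_vector_mult_def P_def diag_def sgn_vec_def pos_part_def max_def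
      if_distrib[of "\<lambda>t. t * _"] cong: if_cong)

lemma newton_matrix_mult: "newton_matrix Q x *v v = (Q - mat 1) *v (P x *v v) + v"
  by (simp add: newton_matrix_def matrix_vector_mult_add_rdistrib matrix_vector_mul_assoc)

lemma sym_pos_def_quadratic_nonneg: "sym_pos_def Q \<Longrightarrow> 0 \<le> x \<bullet> (Q *v x)"
  by (cases "x = 0") (auto simp: sym_pos_def_def less_imp_le)

lemma invertible_newton_matrix:
  assumes "sym_pos_def Q"
  shows "invertible (newton_matrix Q x)"
proof -
  have "v = 0" if "newton_matrix Q x *v v = 0" for v
  proof -
    let ?u = "P x *v v"
    \<comment> \<open>The mask makes the supports of \<open>?u\<close> and \<open>v - ?u\<close>
      disjoint.\<close>
    have orth: "?u \<bullet> (v - ?u) = 0"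
      by (auto simp: inner_vec_def P_mult_nth intro!: sum.neutral)
    have eq: "Q *v ?u + (v - ?u) = 0"
      using that by (simp add: newton_matrix_mult matrix_vector_mult_diff_rdistrib algebra_simps)
    have "?u \<bullet> (Q *v ?u) = ?u \<bullet> (Q *v ?u + (v - ?u))"
      using orth by (simp add: inner_add_right)
    then have "?u \<bullet> (Q *v ?u) = 0"
      using eq by simp
    then have "?u = 0"
      using assms unfolding sym_pos_def_def by (metis less_irrefl)
    with eq show "v = 0"
      by simp
  qed
  then show ?thesis
    by (simp add: invertible_left_inverse matrix_left_invertible_ker)
qed

lemma norm_mult_le_mat_norm: "norm (M *v x) \<le> mat_norm M * norm x"
  unfolding mat_norm_def by (rule onorm[OF matrix_vector_mul_bounded_linear])

lemma mat_norm_nonneg: "0 \<le> mat_norm M"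
  unfolding mat_norm_def by (rule onorm_pos_le[OF matrix_vector_mul_bounded_linear])

lemma norm_P_mult_le: "norm (P x *v v) \<le> norm v"
  by (rule norm_le_componentwise_cart) (simp add: P_mult_nth)

lemma norm_pos_part_diff_le: "norm (pos_part x - pos_part y) \<le> norm (x - y)"
  by (rule norm_le_componentwise_cart) (auto simp: pos_part_def)

text \<open>A component on the left is nonzero only if \<open>y $ i\<close> lies strictly on one
  side of 0 and \<open>x $ i\<close> does not; its modulus \<open>\<bar>y $ i\<bar>\<close> is then
  at most the distance from \<open>y $ i\<close> to \<open>x $ i\<close>.\<close>

lemma norm_pos_part_minus_P_mult_le: "norm (pos_part y - P x *v y) \<le> norm (y - x)"
  by (rule norm_le_componentwise_cart) (auto simp: pos_part_def P_mult_nth)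

lemma ex1_solves_equation:
  assumes "mat_norm (Q - mat 1) < 1"
  shows "\<exists>!x. solves_equation Q b x"
proof -
  let ?q = "mat_norm (Q - mat 1)"
  let ?f = "\<lambda>x. - b - (Q - mat 1) *v pos_part x"
  have "dist (?f x) (?f y) \<le> ?q * dist x y" for x y
  proof -
    have "dist (?f x) (?f y) = norm ((Q - mat 1) *v (pos_part y - pos_part x))"
      by (simp add: dist_norm matrix_vector_mult_diff_distrib)
    also have "\<dots> \<le> ?q * norm (pos_part y - pos_part x)"
      by (rule norm_mult_le_mat_norm)
    also have "\<dots> \<le> ?q * norm (y - x)"
      by (intro mult_left_mono norm_pos_part_diff_le mat_norm_nonneg)
    finally show ?thesis
      by (simp add: dist_norm norm_minus_commute)
  qed
  then have "\<exists>!x. ?f x = x"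
    by (intro banach_fix_type[OF mat_norm_nonneg assms]) blast
  moreover have "?f x = x \<longleftrightarrow> solves_equation Q b x" for x
    by (auto simp: solves_equation_def algebra_simps)
  ultimately show ?thesis
    by simp
qed

text \<open>Replaces the inverse by a linear system, so that the error estimate can subtract
  equations without bounding an inverse.\<close>

lemma newton_step:
  assumes "invertible (newton_matrix Q (newton_seq Q b x0 k))"
  shows "newton_matrix Q (newton_seq Q b x0 k) *v newton_seq Q b x0 (Suc k) = - b"
proof -
  let ?M = "newton_matrix Q (newton_seq Q b x0 k)"
  \<comment> \<open>\<open>matrix_inv\<close> is a Hilbert choice, which invertibility makes a
    genuine inverse.\<close>
  have "?M ** matrix_inv ?M = mat 1"
    using someI_ex[OF assms[unfolded invertible_def]] by (simp add: matrix_inv_def)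
  then show ?thesis
    using linear_neg[OF matrix_vector_mul_linear, of ?M "matrix_inv ?M *v b"]
    by (simp add: matrix_vector_mul_assoc)
qed

lemma newton_error_le:
  assumes z: "newton_matrix Q x *v z = - b" and y: "solves_equation Q b y"
    and q: "mat_norm (Q - mat 1) < 1"
  shows "norm (y - z) \<le> mat_norm (Q - mat 1) / (1 - mat_norm (Q - mat 1)) * norm (y - x)"
proof -
  let ?A = "Q - mat 1" and ?q = "mat_norm (Q - mat 1)"
  \<comment> \<open>This is \<open>pos_part y - P x *v z\<close>, split at \<open>P x *v y\<close>
    into the new error under the mask and a term controlled by the old error.\<close>
  let ?w = "P x *v (y - z) + (pos_part y - P x *v y)"
  have "?A *v (P x *v z) + z = ?A *v pos_part y + y"
    using z y by (simp add: newton_matrix_mult solves_equation_def)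
  then have "y - z = ?A *v (P x *v z) - ?A *v pos_part y"
    by (simp add: algebra_simps)
  also have "\<dots> = - (?A *v ?w)"
    by (simp add: matrix_vector_mult_diff_distrib matrix_vector_right_distrib)
  finally have "norm (y - z) = norm (?A *v ?w)"
    by (metis norm_minus_cancel)
  also have "\<dots> \<le> ?q * norm ?w"
    by (rule norm_mult_le_mat_norm)
  also have "\<dots> \<le> ?q * (norm (y - z) + norm (y - x))"
    by (intro mult_left_mono mat_norm_nonneg norm_triangle_le add_mono norm_P_mult_le
        norm_pos_part_minus_P_mult_le)
  \<comment> \<open>Absorb \<open>?q * norm (y - z)\<close> on the left and divide by
    \<open>1 - ?q > 0\<close>.\<close>
  finally show ?thesis
    using q by (simp add: field_simps)
qed

lemma q_linearly_convergentI:
  assumes r: "0 \<le> r" "r < 1" and step: "\<And>k. norm (l - X (Suc k)) \<le> r * norm (l - X k)"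
  shows "q_linearly_convergent X l"
proof -
  have bound: "norm (X k - l) \<le> norm (l - X 0) * r ^ k" for k
  proof (induction k)
    case (Suc k)
    have "norm (X (Suc k) - l) \<le> r * norm (X k - l)"
      using step[of k] by (simp add: norm_minus_commute)
    also have "\<dots> \<le> r * (norm (l - X 0) * r ^ k)"
      by (rule mult_left_mono[OF Suc r(1)])
    finally show ?case
      by (simp add: mult_ac)
  qed (simp add: norm_minus_commute)
  have "(\<lambda>k. norm (l - X 0) * r ^ k) \<longlonglongrightarrow> 0"
    using r by (intro tendsto_mult_right_zero LIMSEQ_power_zero) simp
  then have "(\<lambda>k. X k - l) \<longlonglongrightarrow> 0"
    by (rule Lim_null_comparison[rotated]) (simp add: bound)
  then have "X \<longlonglongrightarrow> l"
    by (rule LIM_zero_cancel)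
  with r step show ?thesis
    unfolding q_linearly_convergent_def by (auto intro!: exI[of _ r])
qed

text \<open>Exact second-order Taylor expansion at \<open>p\<close>, with gradient
  \<open>Q *v p + b\<close>; symmetry merges the two cross terms.\<close>

lemma quadratic_objective_diff:
  assumes "transpose Q = Q"
  shows "quadratic_objective Q b c y - quadratic_objective Q b c p
    = 1 / 2 * ((y - p) \<bullet> (Q *v (y - p))) + (y - p) \<bullet> (Q *v p + b)"
proof -
  have "p \<bullet> (Q *v y) = y \<bullet> (Q *v p)"
    using dot_lmul_matrix[of p Q y] assms
    by (metis inner_commute transpose_matrix_vector)
  then show ?thesis
    by (simp add: quadratic_objective_def matrix_vector_mult_diff_distrib inner_diff_left
        inner_diff_right inner_add_right field_simps)
qed

lemma is_arg_min_quadratic_objective: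
  assumes Q: "sym_pos_def Q" and x: "solves_equation Q b x"
  shows "is_arg_min (quadratic_objective Q b c) (\<lambda>x. x \<in> nonneg_orthant) (pos_part x)"
proof -
  let ?p = "pos_part x"
  have grad: "Q *v ?p + b = ?p - x"
    using x by (simp add: solves_equation_def matrix_vector_mult_diff_rdistrib algebra_simps)
  have "quadratic_objective Q b c ?p \<le> quadratic_objective Q b c y" if "y \<in> nonneg_orthant" for y
  proof -
    \<comment> \<open>Componentwise: where \<open>x $ i \<ge> 0\<close> the second factor vanishes;
      elsewhere the product is \<open>y $ i * (- x $ i)\<close>.\<close>
    have "0 \<le> (y - ?p) \<bullet> (?p - x)"
      using that unfolding inner_vec_def nonneg_orthant_def
      by (intro sum_nonneg) (auto simp: pos_part_def max_def mult_nonneg_nonpos)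
    then have "0 \<le> quadratic_objective Q b c y - quadratic_objective Q b c ?p"
      using Q sym_pos_def_quadratic_nonneg[OF Q]
      by (subst quadratic_objective_diff) (auto simp: sym_pos_def_def grad)
    then show ?thesis
      by simp
  qed
  moreover have "?p \<in> nonneg_orthant"
    by (simp add: nonneg_orthant_def pos_part_def)
  ultimately show ?thesis
    by (auto simp: is_arg_min_def not_less)
qed

theorem theorem4:
  fixes Q :: "real ^ 'n ^ 'n" and b :: "real ^ 'n" and c :: real
  assumes "sym_pos_def Q"
  shows "(\<forall>x0. newton_well_defined Q b x0) \<and>
    (mat_norm (Q - mat 1) < 1 / 2 \<longrightarrow>
      (\<exists>xstar. solves_equation Q b xstar \<and>
        (\<forall>y. solves_equation Q b y \<longrightarrow> y = xstar) \<and>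
        (\<forall>x0. q_linearly_convergent (newton_seq Q b x0) xstar \<and>
          (\<forall>k. norm (xstar - newton_seq Q b x0 (Suc k))
            \<le> mat_norm (Q - mat 1) / (1 - mat_norm (Q - mat 1))
                * norm (xstar - newton_seq Q b x0 k))) \<and>
        is_arg_min (quadratic_objective Q b c) (\<lambda>x. x \<in> nonneg_orthant) (pos_part xstar)))"
proof (intro conjI impI)
  show "\<forall>x0. newton_well_defined Q b x0"
    using invertible_newton_matrix[OF assms] by (simp add: newton_well_defined_def)
next
  let ?q = "mat_norm (Q - mat 1)"
  let ?r = "?q / (1 - ?q)"
  assume q: "?q < 1 / 2"
  then obtain xstar where sol: "solves_equation Q b xstar"
    and uniq: "\<forall>y. solves_equation Q b y \<longrightarrow> y = xstar"
    using ex1_solves_equation[of Q b] by auto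
  \<comment> \<open>The bound 1/2 enters here: for \<open>?q < 1\<close>, \<open>?r < 1\<close> is
    equivalent to \<open>?q < 1 / 2\<close>.\<close>
  have r: "0 \<le> ?r" "?r < 1"
    using q mat_norm_nonneg[of "Q - mat 1"] by (simp_all add: field_simps)
  have step: "norm (xstar - newton_seq Q b x0 (Suc k)) \<le> ?r * norm (xstar - newton_seq Q b x0 k)"
    for x0 k
    using q by (intro newton_error_le[OF newton_step[OF invertible_newton_matrix[OF assms]] sol]) simp
  have conv: "q_linearly_convergent (newton_seq Q b x0) xstar" for x0
    by (rule q_linearly_convergentI) (fact r step)+
  show "\<exists>xstar. solves_equation Q b xstar \<and>
        (\<forall>y. solves_equation Q b y \<longrightarrow> y = xstar) \<and>
        (\<forall>x0. q_linearly_convergent (newton_seq Q b x0) xstar \<and>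
          (\<forall>k. norm (xstar - newton_seq Q b x0 (Suc k)) \<le> ?r * norm (xstar - newton_seq Q b x0 k))) \<and>
        is_arg_min (quadratic_objective Q b c) (\<lambda>x. x \<in> nonneg_orthant) (pos_part xstar)"
    using sol uniq step conv is_arg_min_quadratic_objective[OF assms sol]
    by blast
qed

end
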